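(* Let $\gamma\in\mathbb{R}$, $\epsilon_1>0$, and let $(\eta,\zeta,\vartheta,\alpha)$ be a solution to the solitary wave problem (described in the context) with $\alpha>0$. If $\eta\ge1$ on the surface $\Gamma$, then either $$\alpha=\frac{1}{F^2}<1-\gamma+\epsilon_1$$ holds, or the solution is trivial.
   Context: Let $\mathcal{R}=\{(x,y):0<y<1\}$ with top $\Gamma=\{y=1\}$ and bottom $\mathcal{B}=\{y=0\}$, and fix $\beta\in(0,1)$. $F$ is the Froude number and $\alpha=1/F^2$. A solution $(\eta,\zeta,\vartheta,\alpha)$ of the solitary wave problem satisfies: $$\Delta\eta=\Delta\zeta=0\text{ in }\mathcal{R},\quad \zeta=1-\tfrac12\gamma-\tfrac12\gamma\eta^2\text{ on }\Gamma,$$ $$(\zeta_y+\gamma\eta\eta_y)^2+\epsilon_1=(1+\epsilon_1-2\alpha(\eta-1))|\nabla\eta|^2\text{ on }\Gamma,\quad \eta=\zeta=0\text{ on }\mathcal{B},\quad \vartheta\equiv y;$$ $\eta,\zeta\in C_{\mathrm b}^{3+\beta}(\overline{\mathcal{R}})$ (bounded Hölder functions) and both are even in $x$; $w=(w_1,w_2):=(\eta-y,\ \zeta-(1-\gamma)y)$ lies in $(C_0^2(\overline{\mathcal{R}}))^2$, i.e. $w$ and its derivatives up to order 2 are bounded, continuous and tend to $0$ uniformly as $|(x,y)|\to\infty$; and $$\inf_\Gamma(1+\epsilon_1-2\alpha(\eta-1))|\nabla\eta|^2>\epsilon_1,\qquad \inf_{\mathcal{R}}(1+\epsilon_1-2\alpha(\eta-1))^2|\nabla\eta|^2>0.$$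 The solution is trivial if $w\equiv0$, i.e. $\eta=y$, $\zeta=(1-\gamma)y$. *)

theory Defs
  imports "HOL-Analysis.Analysis"
begin

definition strip :: "(real \<times> real) set" where
  "strip = {p. 0 < snd p \<and> snd p < 1}"

definition closed_strip :: "(real \<times> real) set" where
  "closed_strip = {p. 0 \<le> snd p \<and> snd p \<le> 1}"

definition top_boundary :: "(real \<times> real) set" where
  "top_boundary = {p. snd p = 1}"

definition bottom_boundary :: "(real \<times> real) set" where
  "bottom_boundary = {p. snd p = 0}"

lemma closure_strip: "closure strip = closed_strip"
proof -
  have 1: "strip = UNIV \<times> {0<..<1}" and 2: "closed_strip = UNIV \<times> {0..1}"
    by (auto simp: strip_def closed_strip_def)
  show ?thesis
    unfolding 1 2 by (simp add: closure_Times)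
qed

text \<open>
  Derivatives are Frechet derivatives relative to the closed strip: ordinary derivatives in the
  interior, and one-sided in the normal direction on the two boundary lines. For functions that
  are continuously differentiable in this sense these are the continuous extensions
  of the interior derivatives up to the boundary. The derivative is unique at every point of the
  closed strip, so \<^const>\<open>frechet_derivative\<close> is unambiguous whenever the
  function is differentiable there.
\<close>

definition dx :: "(real \<times> real \<Rightarrow> real) \<Rightarrow> real \<times> real \<Rightarrow> real" where
  "dx f p = frechet_derivative f (at p within closed_strip) (1, 0)"

definition dy :: "(real \<times> real \<Rightarrow> real) \<Rightarrow> real \<times> real \<Rightarrow> real" where
  "dy f p = frechet_derivative f (at p within closed_strip) (0, 1)"

definition laplacian :: "(real \<times> real \<Rightarrow> real) \<Rightarrow> real \<times> real \<Rightarrow> real" where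
  "laplacian f p = dx (dx f) p + dy (dy f) p"

definition grad_norm2 :: "(real \<times> real \<Rightarrow> real) \<Rightarrow> real \<times> real \<Rightarrow> real" where
  "grad_norm2 f p = (dx f p)\<^sup>2 + (dy f p)\<^sup>2"

text \<open>
  \<open>Cb_holder k \<beta>\<close> is the space of functions with finite Hoelder norm of order
  \<open>k + \<beta>\<close> on the closed strip: all derivatives up to order \<open>k\<close> exist and are bounded, and those
  of order \<open>k\<close> are globally \<open>\<beta>\<close>-Hoelder (so all of them are continuous).
\<close>

primrec Cb_holder :: "nat \<Rightarrow> real \<Rightarrow> (real \<times> real \<Rightarrow> real) \<Rightarrow> bool" where
  "Cb_holder 0 \<beta> f \<longleftrightarrow> bounded (f ` closed_strip) \<and>
     (\<exists>C. \<forall>p\<in>closed_strip. \<forall>q\<in>closed_strip. \<bar>f p - f q\<bar> \<le> C * dist p q powr \<beta>)"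
| "Cb_holder (Suc k) \<beta> f \<longleftrightarrow> bounded (f ` closed_strip) \<and> f differentiable_on closed_strip \<and>
     Cb_holder k \<beta> (dx f) \<and> Cb_holder k \<beta> (dy f)"

definition vanishing_continuous :: "(real \<times> real \<Rightarrow> real) \<Rightarrow> bool" where
  "vanishing_continuous f \<longleftrightarrow> continuous_on closed_strip f \<and> bounded (f ` closed_strip) \<and>
     (f \<longlongrightarrow> 0) (inf at_infinity (principal closed_strip))"

primrec C_vanishing :: "nat \<Rightarrow> (real \<times> real \<Rightarrow> real) \<Rightarrow> bool" where
  "C_vanishing 0 f \<longleftrightarrow> vanishing_continuous f"
| "C_vanishing (Suc k) f \<longleftrightarrow> vanishing_continuous f \<and> f differentiable_on closed_strip \<and>
     C_vanishing k (dx f) \<and> C_vanishing k (dy f)"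

definition even_in_x :: "(real \<times> real \<Rightarrow> real) \<Rightarrow> bool" where
  "even_in_x f \<longleftrightarrow> (\<forall>(x, y)\<in>closed_strip. f (- x, y) = f (x, y))"

definition w1 :: "(real \<times> real \<Rightarrow> real) \<Rightarrow> real \<times> real \<Rightarrow> real" where
  "w1 \<eta> p = \<eta> p - snd p"

definition w2 :: "real \<Rightarrow> (real \<times> real \<Rightarrow> real) \<Rightarrow> real \<times> real \<Rightarrow> real" where
  "w2 \<gamma> \<zeta> p = \<zeta> p - (1 - \<gamma>) * snd p"

definition trivial_solution ::
  "real \<Rightarrow> (real \<times> real \<Rightarrow> real) \<Rightarrow> (real \<times> real \<Rightarrow> real) \<Rightarrow> bool" where
  "trivial_solution \<gamma> \<eta> \<zeta> \<longleftrightarrow> (\<forall>p\<in>closed_strip. w1 \<eta> p = 0 \<and> w2 \<gamma> \<zeta> p = 0)"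

text \<open>
  The sets under the two infima are bounded below (and nonempty) because \<open>\<eta>\<close> and its
  gradient are bounded, so the real-valued \<^const>\<open>Inf\<close> is the genuine infimum.
\<close>

definition solitary_wave_solution ::
  "real \<Rightarrow> real \<Rightarrow> real \<Rightarrow> (real \<times> real \<Rightarrow> real) \<Rightarrow> (real \<times> real \<Rightarrow> real) \<Rightarrow>
    (real \<times> real \<Rightarrow> real) \<Rightarrow> real \<Rightarrow> bool" where
  "solitary_wave_solution \<beta> \<gamma> \<epsilon>\<^sub>1 \<eta> \<zeta> \<theta> \<alpha> \<longleftrightarrow>
     (\<forall>p\<in>strip. laplacian \<eta> p = 0 \<and> laplacian \<zeta> p = 0) \<and>
     (\<forall>p\<in>top_boundary. \<zeta> p = 1 - 1/2 * \<gamma> - 1/2 * \<gamma> * (\<eta> p)\<^sup>2) \<and>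
     (\<forall>p\<in>top_boundary. (dy \<zeta> p + \<gamma> * \<eta> p * dy \<eta> p)\<^sup>2 + \<epsilon>\<^sub>1
        = (1 + \<epsilon>\<^sub>1 - 2 * \<alpha> * (\<eta> p - 1)) * grad_norm2 \<eta> p) \<and>
     (\<forall>p\<in>bottom_boundary. \<eta> p = 0 \<and> \<zeta> p = 0) \<and>
     (\<forall>p\<in>closed_strip. \<theta> p = snd p) \<and>
     Cb_holder 3 \<beta> \<eta> \<and> Cb_holder 3 \<beta> \<zeta> \<and>
     even_in_x \<eta> \<and> even_in_x \<zeta> \<and>
     C_vanishing 2 (w1 \<eta>) \<and> C_vanishing 2 (w2 \<gamma> \<zeta>) \<and>
     (INF p\<in>top_boundary. (1 + \<epsilon>\<^sub>1 - 2 * \<alpha> * (\<eta> p - 1)) * grad_norm2 \<eta> p) > \<epsilon>\<^sub>1 \<and>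
     (INF p\<in>strip. (1 + \<epsilon>\<^sub>1 - 2 * \<alpha> * (\<eta> p - 1))\<^sup>2 * grad_norm2 \<eta> p) > 0"

end

theory Submission
  imports Defs
begin

text \<open>
  Write \<open>w = \<eta> - y\<close>, \<open>b = 1 - \<gamma>\<close>, and suppose \<open>\<alpha> \<ge> b + \<epsilon>\<^sub>1\<close>. Conservation of vertical momentum in
  the physical plane is, in conformal variables, Cauchy's theorem for
  \<open>((\<zeta>\<^sub>y + i \<zeta>\<^sub>x)\<^sup>2 + \<epsilon>\<^sub>1) / (\<eta>\<^sub>y + i \<eta>\<^sub>x)\<close>; its flux through the bottom is
  \<open>\<integral> (\<zeta>\<^sub>y\<^sup>2 + \<epsilon>\<^sub>1) / \<eta>\<^sub>y\<close>, and since \<open>\<eta>\<^sub>y > 0\<close> there (maximum principle) the integrand is at least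
  \<open>2 b \<zeta>\<^sub>y - b\<^sup>2 \<eta>\<^sub>y + \<epsilon>\<^sub>1 (2 - \<eta>\<^sub>y)\<close>. Using the boundary conditions and Green's identities for
  \<open>1\<close>, \<open>y\<close>, \<open>\<eta>\<close>, \<open>\<zeta>\<close> to rewrite everything on the surface gives
  \<open>\<integral> (\<alpha> - b - \<epsilon>\<^sub>1) w + \<alpha> w w\<^sub>y - b \<gamma> w\<^sup>2 / 2 \<le> 0\<close>. Finally \<open>\<integral> w w\<^sub>y = \<integral>\<integral> |\<nabla>w|\<^sup>2 \<ge> \<integral> w\<^sup>2\<close>, so the nonnegative
  function \<open>(\<alpha> - b - \<epsilon>\<^sub>1) w + (\<alpha> - b \<gamma> / 2) w\<^sup>2\<close> has nonpositive integral and \<open>w = 0\<close> on the surface.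
  As \<open>w\<close> need not be integrable, all integrals are over \<open>[-M, M]\<close> and hold up to errors that vanish
  as \<open>M\<close> tends to infinity.
\<close>

section \<open>Partial derivatives on the closed strip and symmetry of mixed ones\<close>

text \<open>One-variable partial derivatives as relations: candidate derivatives can be written
  explicitly and checked by the real differentiation rules. Horizontal lines never leave the strip,
  so \<open>at x\<close> is unrestricted, whereas vertical ones need the one-sided filter at
  \<open>0\<close> and \<open>1\<close>.\<close>

definition has_dx :: "(real \<times> real \<Rightarrow> real) \<Rightarrow> (real \<times> real \<Rightarrow> real) \<Rightarrow> bool" where
  "has_dx f f' \<longleftrightarrow>
     (\<forall>x. \<forall>y\<in>{0..1}. ((\<lambda>s. f (s, y)) has_real_derivative f' (x, y)) (at x))"

definition has_dy :: "(real \<times> real \<Rightarrow> real) \<Rightarrow> (real \<times> real \<Rightarrow> real) \<Rightarrow> bool" where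
  "has_dy f f' \<longleftrightarrow>
     (\<forall>x. \<forall>y\<in>{0..1}. ((\<lambda>t. f (x, t)) has_real_derivative f' (x, y)) (at y within {0..1}))"

lemma has_dxD:
  "has_dx f f' \<Longrightarrow> y \<in> {0..1} \<Longrightarrow> ((\<lambda>s. f (s, y)) has_real_derivative f' (x, y)) (at x within A)"
  unfolding has_dx_def using has_field_derivative_at_within by blast

lemma has_dyD:
  "has_dy f f' \<Longrightarrow> y \<in> {0..1} \<Longrightarrow>
     ((\<lambda>t. f (x, t)) has_real_derivative f' (x, y)) (at y within {0..1})"
  unfolding has_dy_def by blast

lemma has_dyD_interior:
  assumes "has_dy f f'" "0 < y" "y < 1"
  shows "((\<lambda>t. f (x, t)) has_real_derivative f' (x, y)) (at y)"
proof -
  have "at y within {0..1} = at y"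
    using assms by (simp add: at_within_Icc_at)
  with has_dyD[OF assms(1), of y x] assms show ?thesis by simp
qed

lemma mem_closed_strip [simp]: "(x, y) \<in> closed_strip \<longleftrightarrow> y \<in> {0..1}"
  by (simp add: closed_strip_def)

lemma mem_strip [simp]: "(x, y) \<in> strip \<longleftrightarrow> 0 < y \<and> y < 1"
  by (simp add: strip_def)

lemma differentiable_has_dx:
  assumes "f differentiable_on closed_strip"
  shows "has_dx f (dx f)"
  unfolding has_dx_def
proof (intro allI ballI)
  fix x y :: real assume y: "y \<in> {0..1}"
  let ?D = "frechet_derivative f (at (x, y) within closed_strip)"
  have "f differentiable (at (x, y) within closed_strip)"
    using assms y by (simp add: differentiable_on_def)
  then have D: "(f has_derivative ?D) (at (x, y) within closed_strip)"
    by (simp add: frechet_derivative_works)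
  have "((\<lambda>s. (s, y)) has_derivative (\<lambda>h. (h, 0))) (at x)"
    by (auto intro!: derivative_eq_intros)
  moreover have "(f has_derivative ?D) (at (x, y) within range (\<lambda>s. (s, y)))"
    by (rule has_derivative_subset[OF D]) (use y in auto)
  ultimately have "((\<lambda>s. f (s, y)) has_derivative (\<lambda>h. ?D (h, 0))) (at x)"
    using has_derivative_in_compose by blast
  moreover have "?D (h, 0) = dx f (x, y) * h" for h
    using linear_scale[OF has_derivative_linear[OF D], of h "(1, 0)"] by (simp add: dx_def)
  ultimately show "((\<lambda>s. f (s, y)) has_real_derivative dx f (x, y)) (at x)"
    by (simp add: has_field_derivative_def)
qed

lemma differentiable_has_dy:
  assumes "f differentiable_on closed_strip"
  shows "has_dy f (dy f)"
  unfolding has_dy_def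
proof (intro allI ballI)
  fix x y :: real assume y: "y \<in> {0..1}"
  let ?D = "frechet_derivative f (at (x, y) within closed_strip)"
  have "f differentiable (at (x, y) within closed_strip)"
    using assms y by (simp add: differentiable_on_def)
  then have D: "(f has_derivative ?D) (at (x, y) within closed_strip)"
    by (simp add: frechet_derivative_works)
  have "((\<lambda>t. (x, t)) has_derivative (\<lambda>h. (0, h))) (at y within {0..1})"
    by (auto intro!: derivative_eq_intros)
  moreover have "(f has_derivative ?D) (at (x, y) within (\<lambda>t. (x, t)) ` {0..1})"
    by (rule has_derivative_subset[OF D]) auto
  ultimately have "((\<lambda>t. f (x, t)) has_derivative (\<lambda>h. ?D (0, h))) (at y within {0..1})"
    using has_derivative_in_compose by blast
  moreover have "?D (0, h) = dy f (x, y) * h" for h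
    using linear_scale[OF has_derivative_linear[OF D], of h "(0, 1)"] by (simp add: dy_def)
  ultimately show "((\<lambda>t. f (x, t)) has_real_derivative dy f (x, y)) (at y within {0..1})"
    by (simp add: has_field_derivative_def)
qed

lemma has_dx_unique:
  assumes "has_dx f g" "has_dx f h" "p \<in> closed_strip"
  shows "g p = h p"
  using assms DERIV_unique unfolding has_dx_def by (cases p) fastforce

lemma has_dy_unique:
  assumes "has_dy f g" "has_dy f h" "p \<in> closed_strip"
  shows "g p = h p"
proof -
  obtain x y where p: "p = (x, y)" by fastforce
  with assms(3) have y: "y \<in> {0..1}" by simp
  then have "at y within {0..1} \<noteq> bot"
    by (simp add: trivial_limit_within islimpt_Icc)
  with has_dyD[OF assms(1) y] has_dyD[OF assms(2) y] show ?thesis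
    unfolding p by (rule has_field_derivative_unique)
qed

lemma continuous_on_strip_compose:
  assumes "continuous_on closed_strip f" "continuous_on A g" "continuous_on A h" "h ` A \<subseteq> {0..1}"
  shows "continuous_on A (\<lambda>t. f (g t, h t))"
  by (rule continuous_on_compose2[OF assms(1)]) (use assms in \<open>auto intro!: continuous_intros\<close>)

text \<open>Schwarz's argument: applying the mean value theorem twice, in either order, writes the
  second difference over a small square both as \<open>h * h * fxy\<close> at one point and as
  \<open>h * h * fyx\<close> at another.\<close>

lemma mixed_partials_eq:
  assumes "has_dx f fx" "has_dy f fy" "has_dy fx fxy" "has_dx fy fyx"
    and "continuous_on closed_strip fxy" "continuous_on closed_strip fyx"
    and "p \<in> strip"
  shows "fxy p = fyx p"
proof (rule ccontr)
  assume ne: "fxy p \<noteq> fyx p"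
  obtain a c where p: "p = (a, c)" by fastforce
  with assms have c: "0 < c" "c < 1" by auto
  define e where "e = \<bar>fxy p - fyx p\<bar> / 2"
  have e: "e > 0" using ne by (simp add: e_def)
  have pc: "p \<in> closed_strip" using p c by auto
  obtain d1 where d1: "d1 > 0" "\<And>q. q \<in> closed_strip \<Longrightarrow> dist q p < d1 \<Longrightarrow> dist (fxy q) (fxy p) < e"
    using assms(5) pc e unfolding continuous_on_iff by blast
  obtain d2 where d2: "d2 > 0" "\<And>q. q \<in> closed_strip \<Longrightarrow> dist q p < d2 \<Longrightarrow> dist (fyx q) (fyx p) < e"
    using assms(6) pc e unfolding continuous_on_iff by blast
  \<comment> \<open>This keeps the square with lower left corner \<open>p\<close> in the strip and
    all its inner points within \<open>2 * h\<close> of \<open>p\<close>, so each value differs by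
    less than \<open>e\<close>, half the assumed gap.\<close>
  define h where "h = min (min d1 d2 / 2) ((1 - c) / 2)"
  have h: "h > 0" "c + h < 1" "2 * h \<le> d1" "2 * h \<le> d2"
    using c d1(1) d2(1) by (auto simp: h_def min_def field_simps)
  define \<Delta> where "\<Delta> = f (a + h, c + h) - f (a + h, c) - f (a, c + h) + f (a, c)"
  have near: "(x, y) \<in> closed_strip" "dist (x, y) p < d1" "dist (x, y) p < d2"
    if "a < x" "x < a + h" "c < y" "y < c + h" for x y
  proof -
    show "(x, y) \<in> closed_strip" using that c h by auto
    have "dist (x, y) p \<le> dist x a + dist y c"
      unfolding p dist_Pair_Pair by (rule sqrt_sum_squares_le_sum) auto
    also have "\<dots> < 2 * h" using that by (simp add: dist_real_def)
    finally show "dist (x, y) p < d1" "dist (x, y) p < d2" using h by auto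
  qed
  have "\<exists>z>a. z < a + h \<and> (f (a + h, c + h) - f (a + h, c)) - (f (a, c + h) - f (a, c))
          = (a + h - a) * (fx (z, c + h) - fx (z, c))"
    by (rule MVT2) (use c h in \<open>auto intro!: DERIV_diff has_dxD[OF assms(1)]\<close>)
  then obtain x where x: "a < x" "x < a + h" "\<Delta> = h * (fx (x, c + h) - fx (x, c))"
    by (auto simp: \<Delta>_def)
  have "\<exists>z>c. z < c + h \<and> fx (x, c + h) - fx (x, c) = (c + h - c) * fxy (x, z)"
    by (rule MVT2) (use c h in \<open>auto intro!: has_dyD_interior[OF assms(3)]\<close>)
  then obtain y where y: "c < y" "y < c + h" "\<Delta> = h * (h * fxy (x, y))"
    using x by auto
  have "\<exists>z>c. z < c + h \<and> (f (a + h, c + h) - f (a, c + h)) - (f (a + h, c) - f (a, c))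
          = (c + h - c) * (fy (a + h, z) - fy (a, z))"
    by (rule MVT2) (use c h in \<open>auto intro!: DERIV_diff has_dyD_interior[OF assms(2)]\<close>)
  then obtain y' where y': "c < y'" "y' < c + h" "\<Delta> = h * (fy (a + h, y') - fy (a, y'))"
    by (auto simp: \<Delta>_def)
  have "\<exists>z>a. z < a + h \<and> fy (a + h, y') - fy (a, y') = (a + h - a) * fyx (z, y')"
    by (rule MVT2) (use c h y' in \<open>auto intro!: has_dxD[OF assms(4)]\<close>)
  then obtain x' where x': "a < x'" "x' < a + h" "\<Delta> = h * (h * fyx (x', y'))"
    using y' by auto
  have "fxy (x, y) = fyx (x', y')"
    using y(3) x'(3) h by simp
  moreover have "\<bar>fxy (x, y) - fxy p\<bar> < e"
    using d1(2)[of "(x, y)"] near[of x y] x y by (simp add: dist_real_def)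
  moreover have "\<bar>fyx (x', y') - fyx p\<bar> < e"
    using d2(2)[of "(x', y')"] near[of x' y'] x' y' by (simp add: dist_real_def)
  ultimately show False
    using ne unfolding e_def by (smt (verit) field_sum_of_halves)
qed

section \<open>Divergence theorem on rectangles and its limit\<close>

text \<open>Integrate \<open>Qy\<close> in \<open>y\<close> directly, and \<open>Px\<close> in
  \<open>x\<close> after exchanging the order of integration.\<close>

lemma divergence_rectangle:
  assumes "has_dx P Px" "has_dy Q Qy"
    and contP: "continuous_on closed_strip P" and contPx: "continuous_on closed_strip Px"
    and contQ: "continuous_on closed_strip Q" and contQy: "continuous_on closed_strip Qy"
    and D: "\<And>p. p \<in> strip \<Longrightarrow> Px p + Qy p = D p"
    and M: "0 \<le> M"
  shows "integral {-M..M} (\<lambda>x. Q (x, 1) - Q (x, 0)) + integral {0..1} (\<lambda>y. P (M, y) - P (-M, y))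
    = integral {-M..M} (\<lambda>x. integral {0..1} (\<lambda>y. D (x, y)))"
proof -
  have ftcP: "integral {-M..M} (\<lambda>x. Px (x, y)) = P (M, y) - P (-M, y)" if "y \<in> {0..1}" for y
    by (rule integral_unique, rule fundamental_theorem_of_calculus)
      (use M that in \<open>auto intro!: has_dxD[OF assms(1)] simp flip: has_real_derivative_iff_has_vector_derivative\<close>)
  have ftcQ: "integral {0..1} (\<lambda>y. Qy (x, y)) = Q (x, 1) - Q (x, 0)" for x
    by (rule integral_unique, rule fundamental_theorem_of_calculus)
      (auto intro!: has_dyD[OF assms(2)] simp flip: has_real_derivative_iff_has_vector_derivative)
  have sub: "cbox (-M, 0) (M, 1) \<subseteq> closed_strip"
    by (auto simp: cbox_Pair_eq)
  have cP: "continuous_on (cbox (-M, 0) (M, 1)) (\<lambda>(x, y). Px (x, y))"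
    using continuous_on_subset[OF contPx sub] by (simp add: case_prod_unfold)
  have "continuous_on (cbox (-M, 0) (M, 1)) (\<lambda>(x, y). Qy (x, y))"
    using continuous_on_subset[OF contQy sub] by (simp add: case_prod_unfold)
  have swap: "integral {-M..M} (\<lambda>x. integral {0..1} (\<lambda>y. Px (x, y)))
      = integral {0..1} (\<lambda>y. P (M, y) - P (-M, y))"
    proof -
    have "integral {-M..M} (\<lambda>x. integral {0..1} (\<lambda>y. Px (x, y)))
      = integral {0..1} (\<lambda>y. integral {-M..M} (\<lambda>x. Px (x, y)))"
      using integral_swap_continuous[OF cP] by simp
    also have "\<dots> = integral {0..1} (\<lambda>y. P (M, y) - P (-M, y))"
      by (rule integral_cong) (rule ftcP)
    finally show ?thesis .
  qed
  have inner: "integral {0..1} (\<lambda>y. D (x, y))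
      = integral {0..1} (\<lambda>y. Px (x, y)) + (Q (x, 1) - Q (x, 0))" for x
  proof -
    \<comment> \<open>The divergence is prescribed only for \<open>0 < y < 1\<close>; removing the
      endpoints leaves the integral unchanged.\<close>
    have "integral {0..1} (\<lambda>y. D (x, y)) = integral {0..1} (\<lambda>y. Px (x, y) + Qy (x, y))"
      unfolding integral_open_interval_real by (rule integral_cong) (simp add: D)
    also have "\<dots> = integral {0..1} (\<lambda>y. Px (x, y)) + integral {0..1} (\<lambda>y. Qy (x, y))"
      by (intro integral_add integrable_continuous_interval
          continuous_on_strip_compose[OF contPx] continuous_on_strip_compose[OF contQy]
          continuous_intros) auto
    finally show ?thesis by (simp add: ftcQ)
  qed
  have "continuous_on {-M..M} (\<lambda>x. integral (cbox 0 1) (\<lambda>y. Px (x, y)))"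
    by (rule integral_continuous_on_param)
      (use cP in \<open>simp add: cbox_Pair_eq\<close>)
  then have "integral {-M..M} (\<lambda>x. integral {0..1} (\<lambda>y. Px (x, y)) + (Q (x, 1) - Q (x, 0)))
    = integral {-M..M} (\<lambda>x. integral {0..1} (\<lambda>y. Px (x, y))) + integral {-M..M} (\<lambda>x. Q (x, 1) - Q (x, 0))"
    by (intro integral_add integrable_continuous_interval continuous_intros
        continuous_on_strip_compose[OF contQ]) auto
  with swap show ?thesis
    by (simp add: inner)
qed

abbreviation vanishes :: "(real \<times> real \<Rightarrow> real) \<Rightarrow> bool" where
  "vanishes f \<equiv> (f \<longlongrightarrow> 0) (inf at_infinity (principal closed_strip))"

lemma vanishes_iff:
  "vanishes f \<longleftrightarrow> (\<forall>e>0. \<exists>R. \<forall>x. \<forall>y\<in>{0..1}. R \<le> norm (x, y) \<longrightarrow> \<bar>f (x, y)\<bar> < e)"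
  unfolding tendsto_iff eventually_inf_principal eventually_at_infinity
  by (simp add: dist_real_def closed_strip_def imp_conjL Ball_def) metis

text \<open>The ends of the rectangle have length 1, so the flux through them is controlled by the
  supremum of \<open>\<bar>P\<bar>\<close> there, which tends to 0 as the ends move out.\<close>

lemma flux_tendsto:
  assumes "has_dx P Px" "has_dy Q Qy"
    and contP: "continuous_on closed_strip P" and contPx: "continuous_on closed_strip Px"
    and contQ: "continuous_on closed_strip Q" and contQy: "continuous_on closed_strip Qy"
    and D: "\<And>p. p \<in> strip \<Longrightarrow> Px p + Qy p = D p"
    and van: "vanishes P"
  shows "((\<lambda>M. integral {-M..M} (\<lambda>x. Q (x, 1) - Q (x, 0))
           - integral {-M..M} (\<lambda>x. integral {0..1} (\<lambda>y. D (x, y)))) \<longlongrightarrow> 0) at_top"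
  unfolding tendsto_iff
proof (intro allI impI)
  fix e :: real assume e: "e > 0"
  obtain R where R: "\<And>x y. y \<in> {0..1} \<Longrightarrow> R \<le> norm (x, y) \<Longrightarrow> \<bar>P (x, y)\<bar> < e / 4"
    using van e unfolding vanishes_iff by (meson zero_less_divide_iff zero_less_numeral)
  show "eventually (\<lambda>M. dist (integral {-M..M} (\<lambda>x. Q (x, 1) - Q (x, 0))
           - integral {-M..M} (\<lambda>x. integral {0..1} (\<lambda>y. D (x, y)))) 0 < e) at_top"
    using eventually_ge_at_top[of "max 0 R"]
  proof eventually_elim
    case (elim M)
    have nrm: "R \<le> norm (M, y)" "R \<le> norm (-M, y)" for y :: real
      using elim norm_fst_le[of M y] norm_fst_le[of "-M" y] by auto
    have "norm (integral {0..1} (\<lambda>y. P (M, y) - P (-M, y))) \<le> e / 2 * (1 - 0)"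
    proof (rule integral_bound)
      show "continuous_on {0..1} (\<lambda>y. P (M, y) - P (-M, y))"
        by (intro continuous_intros continuous_on_strip_compose[OF contP]) auto
      fix y :: real assume "y \<in> {0..1}"
      then show "norm (P (M, y) - P (-M, y)) \<le> e / 2"
        using R[of y M] R[of y "-M"] nrm[of y] by (auto simp: abs_if split: if_splits)
    qed simp
    with divergence_rectangle[OF assms(1-7), of M] elim e show ?case
      by (simp add: dist_real_def)
  qed
qed

section \<open>Maximum principle\<close>

lemma no_interior_min:
  assumes dx: "has_dx v vx" "has_dx vx vxx" and dy: "has_dy v vy" "has_dy vy vyy"
    and p: "p \<in> strip" and neg: "vxx p + vyy p < 0"
  shows "\<exists>q\<in>closed_strip. v q < v p"
proof (rule ccontr)
  assume "\<not> ?thesis"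
  then have min: "v p \<le> v q" if "q \<in> closed_strip" for q using that by force
  obtain a c where pe: "p = (a, c)" by fastforce
  have c: "0 < c" "c < 1" using p pe by auto
  \<comment> \<open>Second derivative test in one variable: if \<open>l < 0\<close>, then
    \<open>f'\<close> is 0 at \<open>z\<close> and negative just to its right, so \<open>f\<close>
    drops below \<open>f z\<close>. It is applied along both coordinate directions.\<close>
  have *: "l \<ge> 0" if f: "\<And>t. \<bar>t - z\<bar> < d \<Longrightarrow> (f has_real_derivative f' t) (at t)"
    and f': "(f' has_real_derivative l) (at z)" and d: "0 < d"
    and mn: "\<And>t. \<bar>t - z\<bar> < d \<Longrightarrow> f z \<le> f t" for f f' :: "real \<Rightarrow> real" and z d l
  proof (rule ccontr)
    assume "\<not> 0 \<le> l"
    have "f' z = 0"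
      by (rule DERIV_local_min[OF f[of z] d]) (use d mn in \<open>auto simp: abs_minus_commute\<close>)
    moreover obtain k where k: "k > 0" "\<And>h. 0 < h \<Longrightarrow> h < k \<Longrightarrow> f' (z + h) < f' z"
      using DERIV_neg_dec_right[OF f'] \<open>\<not> 0 \<le> l\<close> by auto
    define h where "h = min k d / 2"
    have h: "0 < h" "h < k" "h < d" using k d by (auto simp: h_def)
    have "\<exists>s>z. s < z + h \<and> f (z + h) - f z = (z + h - z) * f' s"
      by (rule MVT2) (use h f in auto)
    then obtain s where s: "z < s" "s < z + h" "f (z + h) - f z = h * f' s" by auto
    have "f' s < f' z" using k(2)[of "s - z"] s h by auto
    ultimately have "f (z + h) < f z"
      using s(3) h mult_pos_neg[of h "f' s"] by simp
    with mn[of "z + h"] h show False by auto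
  qed
  have "0 \<le> vxx p"
    unfolding pe
  proof (rule *[where d = 1])
    show "((\<lambda>s. v (s, c)) has_real_derivative vx (t, c)) (at t)" for t
      by (rule has_dxD[OF dx(1)]) (use c in auto)
    show "((\<lambda>s. vx (s, c)) has_real_derivative vxx (a, c)) (at a)"
      by (rule has_dxD[OF dx(2)]) (use c in auto)
    show "v (a, c) \<le> v (t, c)" for t
      using min[of "(t, c)"] pe c by auto
  qed simp
  moreover have "0 \<le> vyy p"
    unfolding pe
  proof (rule *[where d = "min c (1 - c)"])
    show "((\<lambda>s. v (a, s)) has_real_derivative vy (a, t)) (at t)" if "\<bar>t - c\<bar> < min c (1 - c)" for t
      by (rule has_dyD_interior[OF dy(1)]) (use c that in auto)
    show "((\<lambda>s. vy (a, s)) has_real_derivative vyy (a, c)) (at c)"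
      by (rule has_dyD_interior[OF dy(2)]) (use c in auto)
    show "v (a, c) \<le> v (a, t)" if "\<bar>t - c\<bar> < min c (1 - c)" for t
      using min[of "(a, t)"] pe c that by (auto simp: abs_less_iff)
  qed (use c in auto)
  ultimately show False using neg by linarith
qed

text \<open>Subtracting \<open>e * y^2\<close> makes the Laplacian strictly negative, which excludes
  interior minima. Decay at infinity reduces the unbounded strip to a compact rectangle on which a
  minimum is attained.\<close>

lemma max_principle:
  assumes dx: "has_dx v vx" "has_dx vx vxx" and dy: "has_dy v vy" "has_dy vy vyy"
    and harm: "\<And>p. p \<in> strip \<Longrightarrow> vxx p + vyy p = 0"
    and cont: "continuous_on closed_strip v" and van: "vanishes v"
    and bdry: "\<And>x. 0 \<le> v (x, 0)" "\<And>x. 0 \<le> v (x, 1)"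
    and p: "p \<in> closed_strip"
  shows "0 \<le> v p"
proof (rule ccontr)
  assume "\<not> 0 \<le> v p"
  \<comment> \<open>With this \<open>e\<close> one has \<open>u p \<le> - 2 * e\<close>, while
    \<open>u \<ge> - e\<close> on the boundary lines and \<open>u > - 2 * e\<close> outside
    \<open>K\<close>; the minimum over \<open>K\<close> is thus global and lies in the open
    strip.\<close>
  define e where "e = - v p / 2"
  have e: "e > 0" using \<open>\<not> 0 \<le> v p\<close> by (simp add: e_def)
  define u where "u = (\<lambda>q. v q - e * (snd q)\<^sup>2)"
  obtain R where R: "\<And>x y. y \<in> {0..1} \<Longrightarrow> R \<le> norm (x, y) \<Longrightarrow> \<bar>v (x, y)\<bar> < e"
    using van e unfolding vanishes_iff by meson
  define K where "K = {-(max R (norm p))..max R (norm p)} \<times> {0..1::real}"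
  have pK: "p \<in> K"
    using p norm_fst_le[of "fst p" "snd p"] unfolding K_def by (cases p) auto
  have u_le: "u p \<le> v p" using e by (simp add: u_def)
  have contu: "continuous_on closed_strip u"
    unfolding u_def by (intro continuous_intros cont)
  have "\<exists>q\<in>K. \<forall>r\<in>K. u q \<le> u r"
  proof (rule continuous_attains_inf)
    show "compact K" unfolding K_def by (intro compact_Times compact_Icc)
    show "K \<noteq> {}" using pK by auto
    show "continuous_on K u"
      by (rule continuous_on_subset[OF contu]) (auto simp: K_def)
  qed
  then obtain q where q: "q \<in> K" "\<And>r. r \<in> K \<Longrightarrow> u q \<le> u r" by blast
  have up: "u p \<le> - 2 * e" using u_le by (simp add: e_def)
  have min: "u q \<le> u r" if "r \<in> closed_strip" for r
  proof (cases "r \<in> K")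
    case False
    obtain x y where r: "r = (x, y)" by fastforce
    have y: "y \<in> {0..1}" using that r by auto
    have "R \<le> norm (x, y)" using False r y norm_fst_le[of x y] by (auto simp: K_def)
    then have "\<bar>v (x, y)\<bar> < e" by (rule R[OF y])
    then have "- e < v r" by (simp add: r)
    moreover have "e * y\<^sup>2 \<le> e" using y e by (simp add: power_le_one mult_left_le)
    ultimately have "- 2 * e \<le> u r" by (simp add: u_def r)
    with q(2)[OF pK] up show ?thesis by auto
  qed (use q in auto)
  have "q \<in> strip"
  proof -
    obtain x y where qe: "q = (x, y)" by fastforce
    have "u q \<le> - 2 * e" using q(2)[OF pK] up by auto
    then have "y \<noteq> 0" "y \<noteq> 1" using bdry[of x] e unfolding u_def qe by auto
    with q(1) qe show ?thesis by (auto simp: K_def)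
  qed
  moreover have "\<exists>r\<in>closed_strip. u r < u q"
  proof (rule no_interior_min)
    show "has_dx u vx" using dx(1) unfolding has_dx_def u_def
      by (auto intro!: derivative_eq_intros)
    show "has_dx vx vxx" by fact
    show "has_dy u (\<lambda>q. vy q - 2 * e * snd q)" using dy(1) unfolding has_dy_def u_def
      by (auto intro!: derivative_eq_intros)
    show "has_dy (\<lambda>q. vy q - 2 * e * snd q) (\<lambda>q. vyy q - 2 * e)"
      using dy(2) unfolding has_dy_def
      by (auto intro!: derivative_eq_intros)
    show "vxx q + (vyy q - 2 * e) < 0" using harm[OF \<open>q \<in> strip\<close>] e by simp
  qed fact
  ultimately show False using min leD by blast
qed

section \<open>Decay at infinity and surface functions of zero total integral\<close>

lemma vanishes_cong:
  assumes "vanishes f" "\<And>p. p \<in> closed_strip \<Longrightarrow> f p = g p"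
  shows "vanishes g"
proof (rule Lim_transform_eventually[OF assms(1)])
  show "\<forall>\<^sub>F p in inf at_infinity (principal closed_strip). f p = g p"
    by (simp add: eventually_inf_principal assms(2))
qed

lemma vanishes_bounded_mult:
  assumes "vanishes f" "\<And>p. p \<in> closed_strip \<Longrightarrow> \<bar>g p\<bar> \<le> C"
  shows "vanishes (\<lambda>p. g p * f p)"
proof (rule Lim_null_comparison)
  show "\<forall>\<^sub>F p in inf at_infinity (principal closed_strip). norm (g p * f p) \<le> C * \<bar>f p\<bar>"
    by (simp add: eventually_inf_principal abs_mult assms(2) mult_right_mono)
  show "vanishes (\<lambda>p. C * \<bar>f p\<bar>)"
    using tendsto_mult_right_zero[OF tendsto_rabs_zero[OF assms(1)]] .
qed

text \<open>Replaces the statement that the integral over the whole line is 0, which may fail to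
  make sense without integrability. Continuity is included so that integrals over
  \<open>{-M..M}\<close> are additive.\<close>

definition null :: "(real \<Rightarrow> real) \<Rightarrow> bool" where
  "null q \<longleftrightarrow> continuous_on UNIV q \<and> ((\<lambda>M. integral {-M..M} q) \<longlongrightarrow> 0) at_top"

lemma continuous_integrable_on_Icc:
  fixes q :: "real \<Rightarrow> real"
  assumes "continuous_on UNIV q"
  shows "q integrable_on {a..b}"
  by (rule integrable_continuous_interval) (use assms continuous_on_subset in blast)

lemma null_add: "null q \<Longrightarrow> null r \<Longrightarrow> null (\<lambda>x. q x + r x)"
  unfolding null_def
  by (auto intro!: continuous_intros tendsto_add_zero simp: integral_add continuous_integrable_on_Icc)

lemma null_cmult: "null q \<Longrightarrow> null (\<lambda>x. c * q x)"
  unfolding null_def by (auto intro!: continuous_intros tendsto_mult_right_zero)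

text \<open>The divergence-free case of \<open>flux_tendsto\<close>; every conservation law below is
  an instance with a suitable field \<open>(P, Q)\<close>.\<close>

lemma null_flux:
  assumes "has_dx P Px" "has_dy Q Qy"
    "continuous_on closed_strip P" "continuous_on closed_strip Px"
    "continuous_on closed_strip Q" "continuous_on closed_strip Qy"
    "\<And>p. p \<in> strip \<Longrightarrow> Px p + Qy p = 0" "vanishes P"
  shows "null (\<lambda>x. Q (x, 1) - Q (x, 0))"
  using flux_tendsto[OF assms(1-7)] assms(8)
  by (auto simp: null_def intro!: continuous_intros continuous_on_strip_compose[OF assms(5)])

section \<open>Harmonic perturbations of a linear shear\<close>

text \<open>The common structure of \<eta> (with \<open>c = 1\<close>) and \<zeta> (with
  \<open>c = 1 - \<gamma>\<close>).\<close>

locale perturbed_shear =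
  fixes \<beta> c :: real and f :: "real \<times> real \<Rightarrow> real"
  assumes holder: "Cb_holder 3 \<beta> f"
    and harmonic: "p \<in> strip \<Longrightarrow> laplacian f p = 0"
    and bottom: "f (x, 0) = 0"
    and vanishing: "C_vanishing 2 (\<lambda>p. f p - c * snd p)"
begin

text \<open>The third order of regularity makes the second derivatives differentiable, hence
  continuous up to the boundary.\<close>

lemma diff:
  "f differentiable_on closed_strip"
  "dx f differentiable_on closed_strip" "dy f differentiable_on closed_strip"
  "dx (dx f) differentiable_on closed_strip" "dy (dx f) differentiable_on closed_strip"
  "dx (dy f) differentiable_on closed_strip" "dy (dy f) differentiable_on closed_strip"
  using holder by (auto simp: numeral_3_eq_3)

lemmas has_dx = diff(1-3)[THEN differentiable_has_dx]
lemmas has_dy = diff(1-3)[THEN differentiable_has_dy]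
lemmas cont = diff[THEN differentiable_imp_continuous_on]

lemma has_dx_perturbation: "has_dx (\<lambda>p. f p - c * snd p) (dx f)"
  using has_dx(1) unfolding has_dx_def by (auto intro!: derivative_eq_intros)

lemma has_dy_perturbation: "has_dy (\<lambda>p. f p - c * snd p) (\<lambda>p. dy f p - c)"
  using has_dy(1) unfolding has_dy_def by (auto intro!: derivative_eq_intros)

lemma has_dy_dy_perturbation: "has_dy (\<lambda>p. dy f p - c) (dy (dy f))"
  using has_dy(3) unfolding has_dy_def by (auto intro!: derivative_eq_intros)

text \<open>\<open>C_vanishing\<close> concerns \<open>dx\<close> and \<open>dy\<close> of the
  perturbation; uniqueness of partial derivatives identifies them with \<open>dx f\<close> and
  \<open>dy f - c\<close>.\<close>

lemma vanishes:
  "vanishes (\<lambda>p. f p - c * snd p)" "vanishes (dx f)" "vanishes (\<lambda>p. dy f p - c)"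
proof -
  let ?w = "\<lambda>p. f p - c * snd p"
  have v: "vanishes ?w" "vanishes (dx ?w)" "vanishes (dy ?w)"
    and d: "?w differentiable_on closed_strip"
    using vanishing by (auto simp: numeral_2_eq_2 vanishing_continuous_def)
  show "vanishes ?w" by fact
  show "vanishes (dx f)"
    by (rule vanishes_cong[OF v(2) has_dx_unique[OF differentiable_has_dx[OF d] has_dx_perturbation]])
  show "vanishes (\<lambda>p. dy f p - c)"
    by (rule vanishes_cong[OF v(3) has_dy_unique[OF differentiable_has_dy[OF d] has_dy_perturbation]])
qed

lemma mixed: "p \<in> strip \<Longrightarrow> dy (dx f) p = dx (dy f) p"
  by (rule mixed_partials_eq[OF has_dx(1) has_dy(1) has_dy(2) has_dx(3) cont(5) cont(6)])

lemma dx_dx_eq: "p \<in> strip \<Longrightarrow> dx (dx f) p = - dy (dy f) p"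
  using harmonic[of p] by (simp add: laplacian_def)

lemma dx_bottom: "dx f (x, 0) = 0"
proof -
  have "((\<lambda>s. f (s, 0)) has_real_derivative dx f (x, 0)) (at x)"
    by (rule has_dxD[OF has_dx(1)]) simp
  then show ?thesis
    using DERIV_unique[of "\<lambda>s. f (s, 0)" _ x 0] by (simp add: bottom)
qed

text \<open>Flux of the gradient of \<open>f\<close>, that is, Green's identity with the constant
  1.\<close>

lemma null_dy: "null (\<lambda>x. dy f (x, 1) - dy f (x, 0))"
  by (rule null_flux[OF has_dx(2) has_dy(3) cont(2,4,3,7) _ vanishes(2)]) (simp add: dx_dx_eq)

text \<open>Green's identity with the harmonic function \<open>y\<close>: the field is
  \<open>y \<nabla>f - f \<nabla>y\<close>, whose bottom flux is 0.\<close>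

lemma null_dy_minus: "null (\<lambda>x. dy f (x, 1) - f (x, 1))"
proof -
  have "null (\<lambda>x. (snd (x, 1) * dy f (x, 1) - f (x, 1)) - (snd (x, 0) * dy f (x, 0) - f (x, 0)))"
  proof (rule null_flux)
    show "has_dx (\<lambda>p. snd p * dx f p) (\<lambda>p. snd p * dx (dx f) p)"
      using has_dx(2) unfolding has_dx_def by (auto intro!: derivative_eq_intros)
    show "has_dy (\<lambda>p. snd p * dy f p - f p) (\<lambda>p. snd p * dy (dy f) p)"
      using has_dy(1,3) unfolding has_dy_def by (auto intro!: derivative_eq_intros)
    show "vanishes (\<lambda>p. snd p * dx f p)"
      by (rule vanishes_bounded_mult[OF vanishes(2), of _ 1]) (auto simp: closed_strip_def)
  qed (auto intro!: continuous_intros cont simp: dx_dx_eq)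
  then show ?thesis by (simp add: bottom)
qed

lemma ge_shear:
  assumes "\<And>x. c \<le> f (x, 1)" and p: "p \<in> closed_strip"
  shows "c * snd p \<le> f p"
  using max_principle[OF has_dx_perturbation has_dx(2) has_dy_perturbation has_dy_dy_perturbation
      _ _ vanishes(1) _ _ p] assms(1) harmonic
  by (fastforce intro!: continuous_intros cont simp: laplacian_def bottom)

text \<open>The perturbation is zero on both boundary lines, so the maximum principle applies to it
  and to its negative.\<close>

lemma eq_shear:
  assumes top: "\<And>x. f (x, 1) = c" and p: "p \<in> closed_strip"
  shows "f p = c * snd p"
proof (rule antisym)
  let ?v = "\<lambda>p. - (f p - c * snd p)"
  have "0 \<le> ?v p"
  proof (rule max_principle[OF _ _ _ _ _ _ _ _ _ p])
    show "has_dx ?v (\<lambda>p. - dx f p)" using has_dx(1) unfolding has_dx_def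
      by (auto intro!: derivative_eq_intros)
    show "has_dx (\<lambda>p. - dx f p) (\<lambda>p. - dx (dx f) p)" using has_dx(2) unfolding has_dx_def
      by (auto intro!: derivative_eq_intros)
    show "has_dy ?v (\<lambda>p. c - dy f p)" using has_dy(1) unfolding has_dy_def
      by (auto intro!: derivative_eq_intros)
    show "has_dy (\<lambda>p. c - dy f p) (\<lambda>p. - dy (dy f) p)" using has_dy(3) unfolding has_dy_def
      by (auto intro!: derivative_eq_intros)
    show "vanishes ?v" using tendsto_minus[OF vanishes(1)] by simp
    show "continuous_on closed_strip ?v" by (intro continuous_intros cont)
  qed (use dx_dx_eq in \<open>auto simp: top bottom\<close>)
  then show "f p \<le> c * snd p" by simp
qed (use ge_shear[OF _ p] top in simp)

text \<open>By \<open>ge_shear\<close> the difference quotients \<open>f (x, t) / t\<close> at the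
  bottom are at least \<open>c\<close>.\<close>

lemma dy_bottom_ge:
  assumes "\<And>x. c \<le> f (x, 1)"
  shows "c \<le> dy f (x, 0)"
proof -
  have "((\<lambda>t. f (x, t)) has_real_derivative dy f (x, 0)) (at 0 within {0..1})"
    by (rule has_dyD[OF has_dy(1)]) simp
  then have "((\<lambda>t. f (x, t) / t) \<longlongrightarrow> dy f (x, 0)) (at 0 within {0..1})"
    by (simp add: has_field_derivative_iff bottom)
  moreover have "\<forall>\<^sub>F t in at 0 within {0..1}. c \<le> f (x, t) / t"
    unfolding eventually_at_filter
  proof (intro always_eventually allI impI)
    fix t :: real assume "t \<noteq> 0" "t \<in> {0..1}"
    then show "c \<le> f (x, t) / t"
      using ge_shear[OF assms, of "(x, t)"] by (simp add: field_simps)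
  qed
  moreover have "at 0 within {0..1::real} \<noteq> bot"
    by (simp add: trivial_limit_within islimpt_Icc)
  ultimately show ?thesis by (metis tendsto_lowerbound)
qed

text \<open>For \<open>w = f - c * y\<close> the divergence of \<open>w \<nabla>w\<close> is
  \<open>|\<nabla>w|^2\<close>, and \<open>w\<close> is 0 on the bottom.\<close>

lemma energy_tendsto:
  "((\<lambda>M. integral {-M..M} (\<lambda>x. (f (x, 1) - c) * (dy f (x, 1) - c))
     - integral {-M..M} (\<lambda>x. integral {0..1} (\<lambda>y. (dx f (x, y))\<^sup>2 + (dy f (x, y) - c)\<^sup>2)))
    \<longlongrightarrow> 0) at_top"
proof -
  let ?w = "\<lambda>p. f p - c * snd p"
  have "((\<lambda>M. integral {-M..M} (\<lambda>x. ?w (x, 1) * (dy f (x, 1) - c) - ?w (x, 0) * (dy f (x, 0) - c))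
     - integral {-M..M} (\<lambda>x. integral {0..1} (\<lambda>y. (\<lambda>p. (dx f p)\<^sup>2 + (dy f p - c)\<^sup>2) (x, y))))
    \<longlongrightarrow> 0) at_top"
  proof (rule flux_tendsto)
    show "has_dx (\<lambda>p. ?w p * dx f p) (\<lambda>p. dx f p * dx f p + ?w p * dx (dx f) p)"
      using has_dx(1,2) unfolding has_dx_def
      by (auto intro!: derivative_eq_intros)
    show "has_dy (\<lambda>p. ?w p * (dy f p - c)) (\<lambda>p. (dy f p - c) * (dy f p - c) + ?w p * dy (dy f) p)"
      using has_dy(1,3) unfolding has_dy_def
      by (auto intro!: derivative_eq_intros)
    show "vanishes (\<lambda>p. ?w p * dx f p)"
      using tendsto_mult[OF vanishes(1,2)] by simp
  qed (auto intro!: continuous_intros cont simp: dx_dx_eq power2_eq_square)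
  then show ?thesis by (simp add: bottom)
qed

text \<open>A Poincare inequality on each vertical segment: the surface value of
  \<open>f - c * y\<close> is the integral of its \<open>y\<close>-derivative over a unit
  interval.\<close>

lemma energy_ge:
  "integral {-M..M} (\<lambda>x. (f (x, 1) - c)\<^sup>2)
   \<le> integral {-M..M} (\<lambda>x. integral {0..1} (\<lambda>y. (dx f (x, y))\<^sup>2 + (dy f (x, y) - c)\<^sup>2))"
proof (rule integral_le)
  show "(\<lambda>x. (f (x, 1) - c)\<^sup>2) integrable_on {-M..M}"
    by (intro integrable_continuous_interval continuous_intros continuous_on_strip_compose[OF cont(1)]) auto
  have "continuous_on ({-M..M} \<times> cbox 0 1) (\<lambda>(x, y). (dx f (x, y))\<^sup>2 + (dy f (x, y) - c)\<^sup>2)"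
    unfolding case_prod_unfold
    by (intro continuous_intros continuous_on_strip_compose[OF cont(2)]
        continuous_on_strip_compose[OF cont(3)]) auto
  from integral_continuous_on_param[OF this]
  show "(\<lambda>x. integral {0..1} (\<lambda>y. (dx f (x, y))\<^sup>2 + (dy f (x, y) - c)\<^sup>2)) integrable_on {-M..M}"
    by (intro integrable_continuous_interval) simp
  fix x
  let ?w = "f (x, 1) - c"
  have "((\<lambda>y. dy f (x, y)) has_integral f (x, 1) - f (x, 0)) {0..1}"
    by (rule fundamental_theorem_of_calculus)
      (auto intro!: has_dyD[OF has_dy(1)] simp flip: has_real_derivative_iff_has_vector_derivative)
  \<comment> \<open>Cauchy-Schwarz in linearized form: with \<open>a\<close> the surface value,
    \<open>a * (2 * w_y - a)\<close> integrates to \<open>a^2\<close> and is pointwise at most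
    \<open>w_y^2\<close>.\<close>
  from has_integral_diff[OF has_integral_mult_right[OF this, of "2 * ?w"]
      has_integral_const_real[of "?w * (?w + 2 * c)" 0 1]]
  have "((\<lambda>y. ?w * (2 * (dy f (x, y) - c) - ?w)) has_integral ?w\<^sup>2) {0..1}"
    by (simp add: bottom power2_eq_square algebra_simps)
  moreover have "((\<lambda>y. (dx f (x, y))\<^sup>2 + (dy f (x, y) - c)\<^sup>2) has_integral
     integral {0..1} (\<lambda>y. (dx f (x, y))\<^sup>2 + (dy f (x, y) - c)\<^sup>2)) {0..1}"
    by (intro integrable_integral integrable_continuous_interval continuous_intros
        continuous_on_strip_compose[OF cont(2)] continuous_on_strip_compose[OF cont(3)]) auto
  moreover have "?w * (2 * (dy f (x, y) - c) - ?w) \<le> (dx f (x, y))\<^sup>2 + (dy f (x, y) - c)\<^sup>2" for y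
  proof -
    have "0 \<le> (dx f (x, y))\<^sup>2 + (dy f (x, y) - c - ?w)\<^sup>2" by simp
    then show ?thesis by (simp add: power2_eq_square algebra_simps)
  qed
  ultimately show "?w\<^sup>2 \<le> integral {0..1} (\<lambda>y. (dx f (x, y))\<^sup>2 + (dy f (x, y) - c)\<^sup>2)"
    by (rule has_integral_le)
qed

end

section \<open>Conservation laws of the solitary wave\<close>

locale solitary_wave =
  fixes \<beta> \<gamma> \<epsilon> \<alpha> :: real and \<eta> \<zeta> \<theta> :: "real \<times> real \<Rightarrow> real"
  assumes sol: "solitary_wave_solution \<beta> \<gamma> \<epsilon> \<eta> \<zeta> \<theta> \<alpha>"
    and eps_pos: "0 < \<epsilon>"
    and above: "1 \<le> \<eta> (x, 1)"
begin

sublocale \<eta>: perturbed_shear \<beta> 1 \<eta>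
proof
  have "w1 \<eta> = (\<lambda>p. \<eta> p - 1 * snd p)" by (simp add: w1_def fun_eq_iff)
  with sol show "C_vanishing 2 (\<lambda>p. \<eta> p - 1 * snd p)"
    by (simp add: solitary_wave_solution_def)
qed (use sol in \<open>auto simp: solitary_wave_solution_def bottom_boundary_def\<close>)

sublocale \<zeta>: perturbed_shear \<beta> "1 - \<gamma>" \<zeta>
proof
  have "w2 \<gamma> \<zeta> = (\<lambda>p. \<zeta> p - (1 - \<gamma>) * snd p)" by (simp add: w2_def fun_eq_iff)
  with sol show "C_vanishing 2 (\<lambda>p. \<zeta> p - (1 - \<gamma>) * snd p)"
    by (simp add: solitary_wave_solution_def)
qed (use sol in \<open>auto simp: solitary_wave_solution_def bottom_boundary_def\<close>)

lemma \<zeta>_top: "\<zeta> (x, 1) = 1 - \<gamma> / 2 - \<gamma> / 2 * (\<eta> (x, 1))\<^sup>2"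
  using sol by (simp add: solitary_wave_solution_def top_boundary_def)

lemma dynamic:
  "(dy \<zeta> (x, 1) + \<gamma> * \<eta> (x, 1) * dy \<eta> (x, 1))\<^sup>2 + \<epsilon>
   = (1 + \<epsilon> - 2 * \<alpha> * (\<eta> (x, 1) - 1)) * grad_norm2 \<eta> (x, 1)"
  using sol by (simp add: solitary_wave_solution_def top_boundary_def)

text \<open>Tangential derivative of the surface relation \<open>\<zeta>_top\<close>.\<close>

lemma dx_\<zeta>_top: "dx \<zeta> (x, 1) = - \<gamma> * \<eta> (x, 1) * dx \<eta> (x, 1)"
proof -
  have "((\<lambda>s. \<eta> (s, 1)) has_real_derivative dx \<eta> (x, 1)) (at x)"
    by (rule has_dxD[OF \<eta>.has_dx(1)]) simp
  then have "((\<lambda>s. 1 - \<gamma> / 2 - \<gamma> / 2 * (\<eta> (s, 1))\<^sup>2) has_real_derivative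
      - \<gamma> * \<eta> (x, 1) * dx \<eta> (x, 1)) (at x)"
    by (auto intro!: derivative_eq_intros)
  moreover have "((\<lambda>s. \<zeta> (s, 1)) has_real_derivative dx \<zeta> (x, 1)) (at x)"
    by (rule has_dxD[OF \<zeta>.has_dx(1)]) simp
  ultimately show ?thesis
    using DERIV_unique by (simp add: \<zeta>_top) blast
qed

lemma dy_\<eta>_bottom: "1 \<le> dy \<eta> (x, 0)"
  by (rule \<eta>.dy_bottom_ge) (rule above)

text \<open>Makes division by \<open>h\<close> legitimate up to the boundary. The reason depends on
  the place: \<open>\<eta>_y \<ge> 1\<close> at the bottom, the dynamic condition with
  \<open>\<epsilon> > 0\<close> on the surface, the positive infimum over \<open>strip\<close>
  inside.\<close>

lemma grad_nonzero:
  assumes "p \<in> closed_strip"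
  shows "grad_norm2 \<eta> p \<noteq> 0"
proof -
  obtain x y where p: "p = (x, y)" by fastforce
  consider "y = 0" | "y = 1" | "p \<in> strip" using assms p by fastforce
  then show ?thesis
  proof cases
    case 1
    then show ?thesis using dy_\<eta>_bottom[of x] p by (simp add: grad_norm2_def \<eta>.dx_bottom)
  next
    case 2
    have "0 < (dy \<zeta> (x, 1) + \<gamma> * \<eta> (x, 1) * dy \<eta> (x, 1))\<^sup>2 + \<epsilon>"
      using eps_pos by (simp add: add_nonneg_pos)
    then show ?thesis using dynamic[of x] p 2 by auto
  next
    case 3
    let ?g = "\<lambda>p. (1 + \<epsilon> - 2 * \<alpha> * (\<eta> p - 1))\<^sup>2 * grad_norm2 \<eta> p"
    have "bdd_below (?g ` strip)"
      by (rule bdd_belowI[of _ 0]) (auto simp: grad_norm2_def)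
    then have "(INF q\<in>strip. ?g q) \<le> ?g p" using 3 by (rule cINF_lower)
    moreover have "0 < (INF q\<in>strip. ?g q)"
      using sol by (simp add: solitary_wave_solution_def)
    ultimately show ?thesis by auto
  qed
qed

definition U :: "real \<times> real \<Rightarrow> real" where
  "U p = (((dy \<zeta> p)\<^sup>2 - (dx \<zeta> p)\<^sup>2 + \<epsilon>) * dy \<eta> p + 2 * dx \<zeta> p * dy \<zeta> p * dx \<eta> p) / grad_norm2 \<eta> p"

definition V :: "real \<times> real \<Rightarrow> real" where
  "V p = (2 * dx \<zeta> p * dy \<zeta> p * dy \<eta> p - ((dy \<zeta> p)\<^sup>2 - (dx \<zeta> p)\<^sup>2 + \<epsilon>) * dx \<eta> p) / grad_norm2 \<eta> p"

text \<open>\<open>(V, U)\<close> is divergence-free because \<open>U + i V = (g\<^sup>2 + \<epsilon>) / h\<close> for the holomorphic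
  functions \<open>g = \<zeta>\<^sub>y + i \<zeta>\<^sub>x\<close> and \<open>h = \<eta>\<^sub>y + i \<eta>\<^sub>x\<close>.\<close>

lemma null_U: "null (\<lambda>x. U (x, 1) - U (x, 0))"
proof (rule null_flux)
  let ?a = "dx \<eta>" and ?e = "dy \<eta>" and ?s = "dx \<zeta>" and ?t = "dy \<zeta>" and ?n = "grad_norm2 \<eta>"
  let ?NV = "\<lambda>p. 2 * ?s p * ?t p * ?e p - ((?t p)\<^sup>2 - (?s p)\<^sup>2 + \<epsilon>) * ?a p"
  let ?NU = "\<lambda>p. ((?t p)\<^sup>2 - (?s p)\<^sup>2 + \<epsilon>) * ?e p + 2 * ?s p * ?t p * ?a p"
  let ?nx = "\<lambda>p. 2 * ?a p * dx ?a p + 2 * ?e p * dx ?e p"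
  let ?ny = "\<lambda>p. 2 * ?a p * dy ?a p + 2 * ?e p * dy ?e p"
  let ?NVx = "\<lambda>p. 2 * (dx ?s p * ?t p + ?s p * dx ?t p) * ?e p + 2 * ?s p * ?t p * dx ?e p
    - ((2 * ?t p * dx ?t p - 2 * ?s p * dx ?s p) * ?a p + ((?t p)\<^sup>2 - (?s p)\<^sup>2 + \<epsilon>) * dx ?a p)"
  let ?NUy = "\<lambda>p. (2 * ?t p * dy ?t p - 2 * ?s p * dy ?s p) * ?e p + ((?t p)\<^sup>2 - (?s p)\<^sup>2 + \<epsilon>) * dy ?e p
    + 2 * (dy ?s p * ?t p + ?s p * dy ?t p) * ?a p + 2 * ?s p * ?t p * dy ?a p"
  let ?Vx = "\<lambda>p. (?NVx p * ?n p - ?NV p * ?nx p) / (?n p * ?n p)"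
  let ?Uy = "\<lambda>p. (?NUy p * ?n p - ?NU p * ?ny p) / (?n p * ?n p)"
  have hn: "has_dx ?n ?nx" "has_dy ?n ?ny"
    using \<eta>.has_dx(2,3) \<eta>.has_dy(2,3) unfolding has_dx_def has_dy_def grad_norm2_def
    by (auto intro!: derivative_eq_intros)
  have "has_dx ?NV ?NVx"
    using \<eta>.has_dx(2,3) \<zeta>.has_dx(2,3) unfolding has_dx_def
    by (auto intro!: derivative_eq_intros simp: algebra_simps)
  then show "has_dx V ?Vx"
    using hn(1) grad_nonzero unfolding has_dx_def V_def
    by (auto intro!: DERIV_divide)
  have "has_dy ?NU ?NUy"
    using \<eta>.has_dy(2,3) \<zeta>.has_dy(2,3) unfolding has_dy_def
    by (auto intro!: derivative_eq_intros simp: algebra_simps)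
  then show "has_dy U ?Uy"
    using hn(2) grad_nonzero unfolding has_dy_def U_def
    by (auto intro!: DERIV_divide)
  have cn: "continuous_on closed_strip ?n"
    unfolding grad_norm2_def by (intro continuous_intros \<eta>.cont)
  show "continuous_on closed_strip V" "continuous_on closed_strip U"
    unfolding V_def U_def
    by (intro continuous_intros \<eta>.cont \<zeta>.cont cn ballI grad_nonzero; assumption)+
  show "continuous_on closed_strip ?Vx" "continuous_on closed_strip ?Uy"
    by (intro continuous_intros \<eta>.cont \<zeta>.cont cn; auto simp: grad_nonzero)+
  show "?Vx p + ?Uy p = 0" if p: "p \<in> strip" for p
  proof -
    \<comment> \<open>Harmonicity and equality of mixed partials are the Cauchy-Riemann equations
      for \<open>g\<close> and \<open>h\<close>; after substituting them a polynomial identity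
      remains.\<close>
    have "(?NVx p * ?n p - ?NV p * ?nx p) + (?NUy p * ?n p - ?NU p * ?ny p) = 0"
      unfolding grad_norm2_def \<eta>.dx_dx_eq[OF p] \<zeta>.dx_dx_eq[OF p] \<eta>.mixed[OF p] \<zeta>.mixed[OF p]
      by algebra
    then show ?thesis by (simp flip: add_divide_distrib)
  qed
  let ?F = "inf at_infinity (principal closed_strip)"
  have lim: "(?e \<longlongrightarrow> 1) ?F" "(?t \<longlongrightarrow> 1 - \<gamma>) ?F"
    using \<eta>.vanishes(3) \<zeta>.vanishes(3) LIM_zero_iff by blast+
  \<comment> \<open>At infinity \<open>g\<close> and \<open>h\<close> tend to the real numbers
    \<open>1 - \<gamma>\<close> and \<open>1\<close>, so the imaginary part of the quotient tends to
    0.\<close>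
  have "(V \<longlongrightarrow> (2 * 0 * (1 - \<gamma>) * 1 - ((1 - \<gamma>)\<^sup>2 - 0\<^sup>2 + \<epsilon>) * 0) / (0\<^sup>2 + 1\<^sup>2)) ?F"
    unfolding V_def grad_norm2_def
    by (intro tendsto_intros lim \<eta>.vanishes \<zeta>.vanishes) simp
  then show "vanishes V" by simp
qed

text \<open>Green's second identity for \<eta> and \<zeta>, both zero on the bottom.\<close>

lemma null_wronskian: "null (\<lambda>x. \<eta> (x, 1) * dy \<zeta> (x, 1) - \<zeta> (x, 1) * dy \<eta> (x, 1))"
proof -
  let ?P = "\<lambda>p. \<eta> p * dx \<zeta> p - \<zeta> p * dx \<eta> p"
  let ?Q = "\<lambda>p. \<eta> p * dy \<zeta> p - \<zeta> p * dy \<eta> p"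
  have "null (\<lambda>x. ?Q (x, 1) - ?Q (x, 0))"
  proof (rule null_flux)
    show "has_dx ?P (\<lambda>p. \<eta> p * dx (dx \<zeta>) p - \<zeta> p * dx (dx \<eta>) p)"
      using \<eta>.has_dx(1,2) \<zeta>.has_dx(1,2) unfolding has_dx_def by (auto intro!: derivative_eq_intros)
    show "has_dy ?Q (\<lambda>p. \<eta> p * dy (dy \<zeta>) p - \<zeta> p * dy (dy \<eta>) p)"
      using \<eta>.has_dy(1,3) \<zeta>.has_dy(1,3) unfolding has_dy_def by (auto intro!: derivative_eq_intros)
    \<comment> \<open>Split \<eta> and \<zeta> into linear part and perturbation; the linear parts
      contribute \<open>y * (\<zeta>_x - (1 - \<gamma>) * \<eta>_x)\<close>, which decays because
      \<open>y\<close> is bounded.\<close>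
    have "vanishes (\<lambda>p. (\<eta> p - 1 * snd p) * dx \<zeta> p - (\<zeta> p - (1 - \<gamma>) * snd p) * dx \<eta> p)"
      using tendsto_diff[OF tendsto_mult[OF \<eta>.vanishes(1) \<zeta>.vanishes(2)]
          tendsto_mult[OF \<zeta>.vanishes(1) \<eta>.vanishes(2)]] by simp
    moreover have "vanishes (\<lambda>p. dx \<zeta> p - (1 - \<gamma>) * dx \<eta> p)"
      using tendsto_diff[OF \<zeta>.vanishes(2) tendsto_mult_right_zero[OF \<eta>.vanishes(2)]] by simp
    then have "vanishes (\<lambda>p. snd p * (dx \<zeta> p - (1 - \<gamma>) * dx \<eta> p))"
      by (rule vanishes_bounded_mult[of _ _ 1]) (auto simp: closed_strip_def)
    ultimately have "vanishes (\<lambda>p. (\<eta> p - 1 * snd p) * dx \<zeta> p - (\<zeta> p - (1 - \<gamma>) * snd p) * dx \<eta> p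
      + snd p * (dx \<zeta> p - (1 - \<gamma>) * dx \<eta> p))"
      by (rule tendsto_add_zero)
    then show "vanishes ?P" by (rule vanishes_cong) (simp add: algebra_simps)
  qed (auto intro!: continuous_intros \<eta>.cont \<zeta>.cont simp: \<eta>.dx_dx_eq \<zeta>.dx_dx_eq)
  then show ?thesis by (simp add: \<eta>.bottom \<zeta>.bottom)
qed

text \<open>On the surface \<open>g = P - \<gamma> \<eta> h\<close> with the real function \<open>P = \<zeta>\<^sub>y + \<gamma> \<eta> \<eta>\<^sub>y\<close>.\<close>

lemma U_top:
  "U (x, 1) = (1 + \<epsilon> - 2 * \<alpha> * (\<eta> (x, 1) - 1)) * dy \<eta> (x, 1)
     - 2 * \<gamma> * \<eta> (x, 1) * dy \<zeta> (x, 1) - \<gamma>\<^sup>2 * (\<eta> (x, 1))\<^sup>2 * dy \<eta> (x, 1)"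
proof -
  have "grad_norm2 \<eta> (x, 1) \<noteq> 0" by (rule grad_nonzero) simp
  \<comment> \<open>Expanding gives \<open>(P^2 + \<epsilon>) / h - 2 * \<gamma> * \<eta> * P +
    \<gamma>^2 * \<eta>^2 * h\<close>; the dynamic condition turns \<open>P^2 + \<epsilon>\<close>
    into a multiple of \<open>|h|^2\<close>, and \<open>U\<close> is the real part.\<close>
  then show ?thesis
    using dynamic[of x] unfolding U_def dx_\<zeta>_top
    by (simp add: nonzero_divide_eq_eq) (simp add: grad_norm2_def, algebra)
qed

text \<open>On the bottom \<open>U = (\<zeta>_y^2 + \<epsilon>) / \<eta>_y\<close>, which is convex
  for \<open>\<eta>_y > 0\<close>; the bound is its tangent plane at the trivial values
  \<open>\<zeta>_y = 1 - \<gamma>\<close>, \<open>\<eta>_y = 1\<close>.\<close>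

lemma U_bottom_ge:
  "0 \<le> U (x, 0) - 2 * (1 - \<gamma>) * dy \<zeta> (x, 0) + ((1 - \<gamma>)\<^sup>2 + \<epsilon>) * dy \<eta> (x, 0) - 2 * \<epsilon>"
proof -
  let ?e = "dy \<eta> (x, 0)" and ?t = "dy \<zeta> (x, 0)"
  have e: "0 < ?e" using dy_\<eta>_bottom[of x] by simp
  have "U (x, 0) = (?t\<^sup>2 + \<epsilon>) / ?e"
    using e by (simp add: U_def grad_norm2_def \<eta>.dx_bottom \<zeta>.dx_bottom power2_eq_square)
  then have "U (x, 0) - 2 * (1 - \<gamma>) * ?t + ((1 - \<gamma>)\<^sup>2 + \<epsilon>) * ?e - 2 * \<epsilon>
    = ((?t - (1 - \<gamma>) * ?e)\<^sup>2 + \<epsilon> * (?e - 1)\<^sup>2) / ?e"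
    using e by (simp add: field_simps power2_eq_square)
  then show ?thesis using e eps_pos by simp
qed

section \<open>Vanishing of the surface perturbation\<close>

lemma top_eq_one:
  assumes "1 - \<gamma> + \<epsilon> \<le> \<alpha>" "0 < \<alpha>"
  shows "\<eta> (x, 1) = 1"
proof -
  let ?b = "1 - \<gamma>"
  let ?w = "\<lambda>x. \<eta> (x, 1) - 1"
  \<comment> \<open>\<open>E\<close> is the function to be shown zero, \<open>R \<ge> 0\<close> is
    the excess in \<open>U_bottom_ge\<close>, \<open>G\<close> is the combination that the
    conservation laws make null, and \<open>D\<close> is the truncated Dirichlet energy of the
    perturbation.\<close>
  define E where "E = (\<lambda>x. 2 * (\<alpha> - ?b - \<epsilon>) * ?w x + (2 * \<alpha> - ?b * \<gamma>) * (?w x)\<^sup>2)"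
  define R where "R = (\<lambda>x. U (x, 0) - 2 * ?b * dy \<zeta> (x, 0) + (?b\<^sup>2 + \<epsilon>) * dy \<eta> (x, 0) - 2 * \<epsilon>)"
  define G where "G = (\<lambda>x. E x + R x + 2 * \<alpha> * (?w x * (dy \<eta> (x, 1) - 1) - (?w x)\<^sup>2))"
  define D where "D = (\<lambda>M. integral {-M..M} (\<lambda>x. integral {0..1}
    (\<lambda>y. (dx \<eta> (x, y))\<^sup>2 + (dy \<eta> (x, y) - 1)\<^sup>2)))"
  have coeff: "0 < 2 * \<alpha> - ?b * \<gamma>"
  proof (cases "?b \<le> 0")
    case True
    then have "?b * \<gamma> \<le> 0" by (simp add: mult_nonpos_nonneg)
    then show ?thesis using assms by simp
  next
    \<comment> \<open>Here \<open>\<gamma> < 1\<close>, so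
      \<open>?b * \<gamma> \<le> ?b \<le> \<alpha> - \<epsilon>\<close>.\<close>
    case False
    then have "?b * \<gamma> \<le> ?b * 1" by (intro mult_left_mono) auto
    moreover have "?b < 2 * \<alpha>" using assms eps_pos by simp
    ultimately show ?thesis by simp
  qed
  have E_nonneg: "0 \<le> E x" for x
    using coeff assms(1) above[of x] by (simp add: E_def)
  \<comment> \<open>The coefficients are chosen so that the bottom terms form \<open>R\<close> up to
    a constant, \<zeta>_y cancels on the surface, and \<eta>_y survives there only in
    \<open>2 * \<alpha> * w * \<eta>_y\<close>.\<close>
  have "null (\<lambda>x. - (?b\<^sup>2 + \<epsilon>) * (dy \<eta> (x, 1) - dy \<eta> (x, 0))
      + (2 * ?b * (dy \<zeta> (x, 1) - dy \<zeta> (x, 0))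
      + (2 * (?b\<^sup>2 + \<epsilon>) * (dy \<eta> (x, 1) - \<eta> (x, 1))
      + (- 2 * ?b * (dy \<zeta> (x, 1) - \<zeta> (x, 1))
      + (- 2 * \<gamma> * (\<eta> (x, 1) * dy \<zeta> (x, 1) - \<zeta> (x, 1) * dy \<eta> (x, 1))
      + - 1 * (U (x, 1) - U (x, 0)))))))"
    by (intro null_add null_cmult null_U null_wronskian \<eta>.null_dy \<zeta>.null_dy
        \<eta>.null_dy_minus \<zeta>.null_dy_minus)
  also have "(\<lambda>x. - (?b\<^sup>2 + \<epsilon>) * (dy \<eta> (x, 1) - dy \<eta> (x, 0))
      + (2 * ?b * (dy \<zeta> (x, 1) - dy \<zeta> (x, 0))
      + (2 * (?b\<^sup>2 + \<epsilon>) * (dy \<eta> (x, 1) - \<eta> (x, 1))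
      + (- 2 * ?b * (dy \<zeta> (x, 1) - \<zeta> (x, 1))
      + (- 2 * \<gamma> * (\<eta> (x, 1) * dy \<zeta> (x, 1) - \<zeta> (x, 1) * dy \<eta> (x, 1))
      + - 1 * (U (x, 1) - U (x, 0))))))) = G"
    unfolding G_def E_def R_def U_top \<zeta>_top
    by (rule ext) (simp add: field_simps power2_eq_square power4_eq_xxxx)
  finally have G: "null G" .
  have contE: "continuous_on UNIV E" and cw: "continuous_on UNIV (\<lambda>x. (?w x)\<^sup>2)"
    and cwe: "continuous_on UNIV (\<lambda>x. ?w x * (dy \<eta> (x, 1) - 1))"
    unfolding E_def
    by (intro continuous_intros continuous_on_strip_compose[OF \<eta>.cont(1)]
        continuous_on_strip_compose[OF \<eta>.cont(3)]; simp)+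
  have bound: "integral {-M..M} E
    \<le> integral {-M..M} G - 2 * \<alpha> * (integral {-M..M} (\<lambda>x. ?w x * (dy \<eta> (x, 1) - 1)) - D M)" for M
  proof -
    \<comment> \<open>\<open>?H\<close> equals \<open>E + R\<close>, so \<open>E \<le> ?H\<close> is
      the bottom estimate.\<close>
    let ?H = "\<lambda>x. G x - 2 * \<alpha> * (?w x * (dy \<eta> (x, 1) - 1) - (?w x)\<^sup>2)"
    have "integral {-M..M} E \<le> integral {-M..M} ?H"
    proof (rule integral_le)
      show "E x \<le> ?H x" for x
        using U_bottom_ge[of x] by (simp add: G_def R_def)
    qed (use G contE cw cwe in \<open>auto simp: null_def intro!: continuous_integrable_on_Icc continuous_intros\<close>)
    also have "\<dots> = integral {-M..M} G
        - 2 * \<alpha> * (integral {-M..M} (\<lambda>x. ?w x * (dy \<eta> (x, 1) - 1)) - integral {-M..M} (\<lambda>x. (?w x)\<^sup>2))"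
      using G cw cwe unfolding null_def
      by (subst integral_diff; (subst integral_mult_right)?; (subst integral_diff)?)
        (auto intro!: continuous_integrable_on_Icc continuous_intros)
    also have "\<dots> \<le> integral {-M..M} G
        - 2 * \<alpha> * (integral {-M..M} (\<lambda>x. ?w x * (dy \<eta> (x, 1) - 1)) - D M)"
      using \<eta>.energy_ge[of M] assms(2) by (simp add: D_def)
    finally show ?thesis .
  qed
  have lim: "((\<lambda>M. integral {-M..M} G
      - 2 * \<alpha> * (integral {-M..M} (\<lambda>x. ?w x * (dy \<eta> (x, 1) - 1)) - D M)) \<longlongrightarrow> 0) at_top"
    using tendsto_diff[OF _ tendsto_mult_right_zero[OF \<eta>.energy_tendsto, of "2 * \<alpha>"]] G
    unfolding null_def D_def by fastforce
  \<comment> \<open>A fixed nondegenerate interval containing \<open>x\<close>. As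
    \<open>E \<ge> 0\<close>, its integral over \<open>{-N..N}\<close> is at most that over
    \<open>{-M..M}\<close> for \<open>M \<ge> N\<close>, whose upper bound tends to 0.\<close>
  define N where "N = \<bar>x\<bar> + 1"
  have "integral {-N..N} E \<le> 0"
  proof (rule tendsto_lowerbound[OF lim])
    show "\<forall>\<^sub>F M in at_top. integral {-N..N} E \<le> integral {-M..M} G
      - 2 * \<alpha> * (integral {-M..M} (\<lambda>x. ?w x * (dy \<eta> (x, 1) - 1)) - D M)"
      using eventually_ge_at_top[of N]
    proof eventually_elim
      case (elim M)
      have "integral {-N..N} E \<le> integral {-M..M} E"
        by (rule integral_subset_le)
          (use elim E_nonneg contE in \<open>auto intro!: continuous_integrable_on_Icc\<close>)
      with bound[of M] show ?case by linarith
    qed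
  qed simp
  moreover have "0 \<le> integral {-N..N} E"
    by (rule integral_nonneg) (use E_nonneg contE in \<open>auto intro!: continuous_integrable_on_Icc\<close>)
  ultimately have "integral {-N..N} E = 0" by simp
  moreover have "continuous_on {-N..N} E" using contE continuous_on_subset by blast
  ultimately have "E x = 0"
    using integral_eq_0_iff[of "-N" N E] E_nonneg by (simp add: N_def abs_if split: if_splits)
  moreover have "0 \<le> 2 * (\<alpha> - ?b - \<epsilon>) * ?w x" "0 \<le> (2 * \<alpha> - ?b * \<gamma>) * (?w x)\<^sup>2"
    using coeff assms(1) above[of x] by simp_all
  ultimately have "(2 * \<alpha> - ?b * \<gamma>) * (?w x)\<^sup>2 = 0" unfolding E_def by linarith
  then show ?thesis using coeff by simp
qed

text \<open>With \<open>\<eta> = 1\<close> on the surface, \<open>\<zeta>_top\<close> gives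
  \<open>\<zeta> = 1 - \<gamma>\<close> there, and \<open>eq_shear\<close> carries both into the
  strip.\<close>

lemma trivial_if_supercritical:
  assumes "1 - \<gamma> + \<epsilon> \<le> \<alpha>" "0 < \<alpha>"
  shows "trivial_solution \<gamma> \<eta> \<zeta>"
proof -
  have "\<eta> (x, 1) = 1" "\<zeta> (x, 1) = 1 - \<gamma>" for x
    using top_eq_one[OF assms, of x] \<zeta>_top[of x] by simp_all
  then show ?thesis
    by (simp add: trivial_solution_def w1_def w2_def \<eta>.eq_shear \<zeta>.eq_shear)
qed

end

theorem theorem2p5:
  fixes \<beta> \<gamma> \<epsilon>\<^sub>1 \<alpha> F :: real
    and \<eta> \<zeta> \<theta> :: "real \<times> real \<Rightarrow> real"
  assumes "0 < \<beta>" and "\<beta> < 1"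
    and "\<epsilon>\<^sub>1 > 0"
    and "\<alpha> = 1 / F\<^sup>2" and "\<alpha> > 0"
    and "solitary_wave_solution \<beta> \<gamma> \<epsilon>\<^sub>1 \<eta> \<zeta> \<theta> \<alpha>"
    and "\<forall>p\<in>top_boundary. \<eta> p \<ge> 1"
  shows "\<alpha> < 1 - \<gamma> + \<epsilon>\<^sub>1 \<or> trivial_solution \<gamma> \<eta> \<zeta>"
proof -
  interpret solitary_wave \<beta> \<gamma> \<epsilon>\<^sub>1 \<alpha> \<eta> \<zeta> \<theta>
    using assms by unfold_locales (auto simp: top_boundary_def)
  show ?thesis
    using trivial_if_supercritical assms(5) by linarith
qed

end
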